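(* There exists an $\ell t \times t$ Vatican design for each pair $$(t,\ell) \in \{(61,10), (71,14), (79,13), (101,20), (109,18), (113,16), (131,26), (151,25), (157,26), (181,36), (191,38), (211,42), (239,34), (251,50), (281,35)\}.$$
   Context: A crossover design with $n$ subjects and $t$ treatments and periods is an $n \times t$ array $D$ of treatments ($D_{ij}$ = treatment given to subject $i$ in period $j$), assumed uniform: each treatment occurs exactly once in each row and exactly $n/t$ times in each column. For distinct treatments $x,y$ and $1\le d\le t-1$, $o_d(x,y)$ is the number of times, over all rows, that $y$ occurs exactly $d$ periods after $x$ in the same row. The design is Vatican if $o_d(x,y) \le n/t$ for all ordered pairs of distinct treatments $(x,y)$ and all $1 \le d \le t-1$. An "$\ell t \times t$ design" has $\ell t$ rows. *)

theory Defs
  imports Complex_Main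
begin

text \<open>An array of size \<open>n\<close> by \<open>t\<close> is a function \<open>D\<close> of which only the values \<open>D i j\<close> with
  \<open>i < n\<close> (subjects, rows) and \<open>j < t\<close> (periods, columns) matter; the \<open>t\<close> treatments are the
  numbers below \<open>t\<close>.\<close>

definition crossover_design :: "nat \<Rightarrow> nat \<Rightarrow> (nat \<Rightarrow> nat \<Rightarrow> nat) \<Rightarrow> bool" where
  "crossover_design n t D \<longleftrightarrow> (\<forall>i<n. \<forall>j<t. D i j < t)"

definition uniform_design :: "nat \<Rightarrow> nat \<Rightarrow> (nat \<Rightarrow> nat \<Rightarrow> nat) \<Rightarrow> bool" where
  "uniform_design n t D \<longleftrightarrow>
     crossover_design n t D \<and>
     (\<forall>i<n. \<forall>x<t. card {j. j < t \<and> D i j = x} = 1) \<and>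
     (\<forall>j<t. \<forall>x<t. real (card {i. i < n \<and> D i j = x}) = real n / real t)"

definition follow_count ::
    "nat \<Rightarrow> nat \<Rightarrow> (nat \<Rightarrow> nat \<Rightarrow> nat) \<Rightarrow> nat \<Rightarrow> nat \<Rightarrow> nat \<Rightarrow> nat" where
  "follow_count n t D d x y =
     card {(i, j). i < n \<and> j + d < t \<and> D i j = x \<and> D i (j + d) = y}"

definition vatican_design :: "nat \<Rightarrow> nat \<Rightarrow> (nat \<Rightarrow> nat \<Rightarrow> nat) \<Rightarrow> bool" where
  "vatican_design n t D \<longleftrightarrow>
     uniform_design n t D \<and>
     (\<forall>d\<in>{1..t - 1}. \<forall>x<t. \<forall>y<t. x \<noteq> y \<longrightarrow>
        real (follow_count n t D d x y) \<le> real n / real t)"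

end

theory Submission
  imports Defs "HOL-Number_Theory.Number_Theory"
begin

text \<open>Let \<open>g\<close> be a primitive root modulo the prime \<open>t = k * l + 1\<close>. The base row is
  \<open>0, 1, g, g\<^sup>2, \<dots>, g\<^bsup>t-2\<^esup>\<close>, and the \<open>l * t\<close> rows of the design are its images under
  \<open>z \<mapsto> c + h * z\<close>, where \<open>c\<close> runs through the residues modulo \<open>t\<close> and \<open>h\<close> through the \<open>k\<close>-th powers,
  so that only the classes modulo \<open>k\<close> of the logarithms of the differences of the base row matter.
  If \<open>g\<^sup>d - 1 = g\<^sup>s\<close>, then the differences at distance \<open>d\<close> are \<open>g\<^sup>s, g\<^bsup>s+1\<^esup>, \<dots>, g\<^bsup>s+t-2-d\<^esup>\<close> and,
  from the initial \<open>0\<close>, the element \<open>g\<^bsup>d-1\<^esup>\<close>. The \<open>t - 1\<close> consecutive exponents starting at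
  \<open>s\<close> meet every class modulo \<open>k\<close> exactly \<open>l\<close> times, so no class is met too often if the exponent
  \<open>d - 1\<close> is congruent to one of the \<open>d\<close> omitted ones, that is, if \<open>s \<equiv> d + i\<close> modulo \<open>k\<close> for some
  \<open>i < d\<close>. This is automatic for \<open>d \<ge> k\<close>, which leaves \<open>k - 1\<close> conditions on \<open>g\<close>.\<close>

section \<open>Multiplicative orders and discrete logarithms\<close>

text \<open>If the order were a proper divisor of \<open>m\<close>, a prime \<open>p\<close> of the
  cofactor would lie in \<open>ps\<close> and already give \<open>a ^ (m div p)\<close> congruent to
  1.\<close>

lemma ord_eqI_prime_list:
  fixes n a m :: nat
  assumes one: "[a ^ m = 1] (mod n)" and m: "foldr (*) ps 1 = m"
    and ps: "list_all (\<lambda>p. prime p \<and> \<not> [a ^ (m div p) = 1] (mod n)) ps"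
  shows "ord n a = m"
proof -
  obtain c where c: "m = ord n a * c"
    using one ord_divides by (metis dvd_def)
  have "c = 1"
  proof (rule ccontr)
    assume "c \<noteq> 1"
    then obtain p where p: "prime p" "p dvd c"
      using prime_factor_nat by blast
    then obtain b where b: "c = p * b"
      by (auto simp: dvd_def)
    have "primefact ps m"
      using m ps by (auto simp: primefact_def list_all_iff)
    moreover have "p dvd m"
      using c p(2) by simp
    ultimately have "p \<in> set ps"
      using p(1) primefact_contains by blast
    then have "\<not> [a ^ (m div p) = 1] (mod n)"
      using ps by (auto simp: list_all_iff)
    moreover have "m div p = ord n a * b"
      using c b prime_gt_0_nat[OF p(1)] by simp
    ultimately show False
      using ord_divides[of a "ord n a * b" n] by simp
  qed
  with c show ?thesis by simp
qed

text \<open>The first \<open>t - 1\<close> powers of \<open>g\<close> are distinct and nonzero,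
  hence fill all nonzero residues. Since \<open>d < t - 1\<close> excludes \<open>g ^ d\<close>
  congruent to 1, the residue of \<open>g ^ d - 1\<close> is among them.\<close>

lemma power_eq_Suc_power_if_ord:
  fixes g t :: nat
  assumes ord: "ord t g = t - 1" and d: "1 \<le> d" "d < t - 1"
  shows "\<exists>s. [g ^ d = Suc (g ^ s)] (mod t)"
proof -
  have t: "1 < t" and cop: "coprime t g"
    using d ord by (auto simp flip: ord_gt_0_iff)
  let ?f = "\<lambda>s. g ^ s mod t"
  have nz: "?f s \<noteq> 0" for s
  proof
    assume "?f s = 0"
    then have "t dvd g ^ s" by auto
    moreover have "coprime t (g ^ s)"
      using cop by simp
    ultimately have "t = 1"
      by (metis coprime_absorb_left nat_dvd_1_iff_1)
    with t show False by simp
  qed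
  have "inj_on ?f {..<t - 1}"
  proof (rule inj_onI)
    fix r s assume "r \<in> {..<t - 1}" "s \<in> {..<t - 1}" "?f r = ?f s"
    then show "r = s"
      using order_divides_expdiff[OF cop, of r s] ord by (simp add: cong_def)
  qed
  then have "card (?f ` {..<t - 1}) = card {1..<t}"
    by (simp add: card_image)
  moreover have "?f ` {..<t - 1} \<subseteq> {1..<t}"
    using nz t by (auto simp: Suc_le_eq)
  ultimately have surj: "?f ` {..<t - 1} = {1..<t}"
    by (simp add: card_subset_eq)
  have "?f d \<noteq> 1"
    using order_divides_expdiff[OF cop, of d 0] ord d t by (auto simp: cong_def)
  then have "?f d - 1 \<in> {1..<t}"
    using nz[of d] t by (auto simp: Suc_le_eq less_imp_diff_less)
  then obtain s where s: "?f s = ?f d - 1"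
    unfolding surj[symmetric] by auto
  have "[g ^ d = Suc (?f s)] (mod t)"
    using s nz[of d] by (simp add: cong_def)
  also have "[Suc (?f s) = Suc (g ^ s)] (mod t)"
    by (simp add: cong_def mod_Suc_eq)
  finally show ?thesis by blast
qed

section \<open>The design and its uniformity\<close>

definition base_row :: "nat \<Rightarrow> nat \<Rightarrow> nat" where
  "base_row g j = (case j of 0 \<Rightarrow> 0 | Suc m \<Rightarrow> g ^ m)"

text \<open>Quotient and remainder of \<open>i\<close> by \<open>l\<close> index the pairs
  \<open>(c, h)\<close>: translation \<open>c = i div l\<close>, multiplier
  \<open>h = g ^ (k * (i mod l))\<close>.\<close>

definition power_design :: "nat \<Rightarrow> nat \<Rightarrow> nat \<Rightarrow> nat \<Rightarrow> nat \<Rightarrow> nat \<Rightarrow> nat" where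
  "power_design t k l g i j = (i div l + g ^ (k * (i mod l)) * base_row g j) mod t"

locale primitive_power_design =
  fixes t k l g :: nat
  assumes t_eq: "t = k * l + 1" and k_pos: "0 < k" and l_pos: "0 < l"
    and ord_g: "ord t g = k * l"
begin

lemma t_gt_1: "1 < t"
  using t_eq k_pos l_pos by simp

lemma coprime_g: "coprime t g"
  using ord_g k_pos l_pos by (simp flip: ord_gt_0_iff)

lemma power_cong_iff: "[g ^ a = g ^ b] (mod t) \<longleftrightarrow> [a = b] (mod k * l)"
  using order_divides_expdiff[OF coprime_g] ord_g by simp

lemma coprime_power: "coprime (g ^ a) t"
  using coprime_g by (simp add: coprime_commute)

lemma not_power_cong_0: "\<not> [g ^ a = 0] (mod t)"
proof
  assume "[g ^ a = 0] (mod t)"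
  then have "is_unit t"
    unfolding cong_0_iff by (rule coprime_common_divisor[OF coprime_power]) simp
  with t_gt_1 show False by simp
qed

lemma base_row_inj:
  assumes "[base_row g j = base_row g j'] (mod t)" "j < t" "j' < t"
  shows "j = j'"
proof (cases j; cases j')
  fix m m' assume j: "j = Suc m" "j' = Suc m'"
  then have "[m = m'] (mod k * l)"
    using assms(1) power_cong_iff by (simp add: base_row_def)
  moreover have "m < k * l" "m' < k * l"
    using assms(2,3) t_eq j by auto
  ultimately show "j = j'"
    using j by (simp add: cong_def)
qed (use assms(1) not_power_cong_0 in \<open>auto simp: base_row_def dest: cong_sym\<close>)

lemma row_unique:
  assumes "[c + g ^ a * z = c' + g ^ a * z] (mod t)" "c < t" "c' < t"
  shows "c = c'"
  using assms unfolding cong_add_rcancel_nat by (rule cong_less_modulus_unique_nat)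

text \<open>Once the multiplier is fixed, a single entry determines the translation.\<close>

lemma row_eqI:
  assumes "i < l * t" "i' < l * t" "i mod l = i' mod l"
    and "power_design t k l g i j = power_design t k l g i' j"
  shows "i = i'"
proof -
  have "i div l < t" "i' div l < t"
    using assms(1,2) by (simp_all add: less_mult_imp_div_less mult.commute)
  then have "i div l = i' div l"
    using assms(3,4) by (intro row_unique) (simp_all add: power_design_def cong_def)
  with assms(3) show ?thesis
    by (metis div_mult_mod_eq)
qed

lemma uniform: "uniform_design (l * t) t (power_design t k l g)"
  unfolding uniform_design_def crossover_design_def
proof (intro conjI allI impI)
  let ?D = "power_design t k l g"
  show D_less: "?D i j < t" for i j
    using t_gt_1 by (simp add: power_design_def)
  show "card {j. j < t \<and> ?D i j = x} = 1" if "i < l * t" "x < t" for i x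
  proof -
    have inj: "inj_on (?D i) {..<t}"
    proof (rule inj_onI)
      fix j j' assume "j \<in> {..<t}" "j' \<in> {..<t}" "?D i j = ?D i j'"
      then show "j = j'"
        by (intro base_row_inj) (simp_all add: power_design_def cong_add_lcancel_nat
            cong_mult_lcancel_nat[OF coprime_power] flip: cong_def)
    qed
    have "?D i ` {..<t} = {..<t}"
      using D_less by (intro endo_inj_surj inj) auto
    then obtain j where "j < t" "?D i j = x"
      using \<open>x < t\<close> by (metis imageE lessThan_iff)
    then have "{j. j < t \<and> ?D i j = x} = {j}"
      using inj by (auto dest: inj_onD)
    then show ?thesis by simp
  qed
  show "real (card {i. i < l * t \<and> ?D i j = x}) = real (l * t) / real t"
    if "j < t" "x < t" for j x
  proof -
    \<comment> \<open>In a fixed column, each of the \<open>l\<close> multipliers admits exactly one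
      translation that produces \<open>x\<close>.\<close>
    have "bij_betw (\<lambda>i. i mod l) {i. i < l * t \<and> ?D i j = x} {..<l}"
      unfolding bij_betw_def
    proof
      show "inj_on (\<lambda>i. i mod l) {i. i < l * t \<and> ?D i j = x}"
        by (rule inj_onI) (auto intro: row_eqI[of _ _ j])
      have "\<exists>i. (i < l * t \<and> ?D i j = x) \<and> a = i mod l" if a: "a < l" for a
      proof -
        let ?v = "g ^ (k * a) * base_row g j"
        \<comment> \<open>This is \<open>x - ?v\<close> modulo \<open>t\<close>, written without
          truncated subtraction.\<close>
        let ?c = "(x + (t - ?v mod t)) mod t"
        let ?i = "?c * l + a"
        have "?c < t"
          using t_gt_1 by simp
        then have "Suc ?c * l \<le> t * l"
          by (intro mult_le_mono1 Suc_leI)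
        then have "?i < l * t"
          using a by (simp add: mult.commute)
        have "?D ?i j = (x + (t - ?v mod t) + ?v mod t) mod t"
          using a by (simp add: power_design_def mod_add_left_eq mod_add_right_eq)
        moreover have "?v mod t < t"
          using t_gt_1 by simp
        then have "x + (t - ?v mod t) + ?v mod t = x + t"
          by linarith
        ultimately have "?D ?i j = x"
          using \<open>x < t\<close> by simp
        moreover have "a = ?i mod l"
          using a by simp
        ultimately show ?thesis
          using \<open>?i < l * t\<close> by blast
      qed
      then show "(\<lambda>i. i mod l) ` {i. i < l * t \<and> ?D i j = x} = {..<l}"
        using l_pos by (auto simp: image_iff)
    qed
    then have "card {i. i < l * t \<and> ?D i j = x} = l"
      by (simp add: bij_betw_same_card)
    then show ?thesis
      using t_gt_1 by simp
  qed
qed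

section \<open>Pairs of treatments at a fixed distance\<close>

text \<open>Each occurrence gets a slot \<open>p j\<close> among \<open>k * l\<close> consecutive
  exponents. The difference of \<open>y\<close> and \<open>x\<close> fixes the class of the slot
  modulo \<open>k\<close>, so \<open>p j div k\<close>, which has \<open>l\<close> values,
  identifies the occurrence. For \<open>d = t - 1\<close> only the pair starting at the initial 0
  exists, and \<open>g ^ d - 1\<close> vanishes modulo \<open>t\<close>, so \<open>s\<close> is a
  logarithm only for smaller \<open>d\<close>.\<close>

lemma follow_count_le:
  assumes d: "1 \<le> d" "d < t" and i: "i < d" and s: "[s = d + i] (mod k)"
    and diff: "d < t - 1 \<Longrightarrow> [g ^ d = Suc (g ^ s)] (mod t)"
  shows "follow_count (l * t) t (power_design t k l g) d x y \<le> l"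
proof -
  let ?D = "power_design t k l g"
  \<comment> \<open>The difference across distance \<open>d\<close> from position \<open>j\<close>
    of the base row is \<open>g ^ e j\<close>.\<close>
  define e where "e j = (if j = 0 then d - 1 else s + (j - 1))" for j
  \<comment> \<open>The initial entry takes the place of position \<open>t - 1 - i\<close>, which has no partner at distance \<open>d\<close>.\<close>
  define p where "p j = (if j = 0 then t - 2 - i else j - 1)" for j
  define S where "S = {(r, j). r < l * t \<and> j + d < t \<and> ?D r j = x \<and> ?D r (j + d) = y}"
  have step: "[base_row g (j + d) = base_row g j + g ^ e j] (mod t)" if "j + d < t" for j
  proof (cases j)
    case 0
    then show ?thesis
      using d by (auto simp: base_row_def e_def split: nat.splits)
  next
    case (Suc m)
    then have "[g ^ m * g ^ d = g ^ m * Suc (g ^ s)] (mod t)"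
      using that by (intro cong_scalar_left diff) auto
    then show ?thesis
      using Suc by (simp add: base_row_def e_def power_add algebra_simps)
  qed
  have y_cong: "[y = x + g ^ (k * (r mod l) + e j)] (mod t)" if "(r, j) \<in> S" for r j
  proof -
    have "[y = r div l + g ^ (k * (r mod l)) * base_row g (j + d)] (mod t)"
      using that by (auto simp: S_def power_design_def cong_def)
    also have "[r div l + g ^ (k * (r mod l)) * base_row g (j + d) =
        r div l + g ^ (k * (r mod l)) * (base_row g j + g ^ e j)] (mod t)"
      using that by (intro cong_add cong_scalar_left step) (auto simp: S_def)
    also have "r div l + g ^ (k * (r mod l)) * (base_row g j + g ^ e j) =
        r div l + g ^ (k * (r mod l)) * base_row g j + g ^ (k * (r mod l) + e j)"
      by (simp add: power_add algebra_simps)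
    also have "[r div l + g ^ (k * (r mod l)) * base_row g j + g ^ (k * (r mod l) + e j) =
        x + g ^ (k * (r mod l) + e j)] (mod t)"
      using that by (intro cong_add) (auto simp: S_def power_design_def cong_def)
    finally show ?thesis .
  qed
  have p_less: "p j < k * l" if "j + d < t" for j
    using that d i t_eq by (auto simp: p_def)
  have p_inj: "j = j'" if "p j = p j'" "j + d < t" "j' + d < t" for j j'
    using that d i by (auto simp: p_def split: if_splits)
  have e_cong: "[e j = s + p j] (mod k)" if "j + d < t" for j
  proof (cases "j = 0")
    case True
    have "[d + i + p 0 = s + p 0] (mod k)"
      using s by (intro cong_add) (simp_all add: cong_sym)
    \<comment> \<open>The slot \<open>t - 2 - i\<close> is chosen so that the excess over
      \<open>d - 1\<close> is \<open>t - 1\<close>, a multiple of \<open>k\<close>.\<close>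
    moreover have "d + i + p 0 = d - 1 + k * l"
      using True that d i t_eq by (simp add: p_def)
    ultimately show ?thesis
      using True by (simp add: e_def cong_def)
  qed (simp add: e_def p_def)
  have "inj_on (\<lambda>(r, j). p j div k) S"
  proof (rule inj_onI, clarify)
    fix r j r' j'
    assume S: "(r, j) \<in> S" "(r', j') \<in> S" and quot: "p j div k = p j' div k"
    have j: "j + d < t" "j' + d < t"
      using S by (auto simp: S_def)
    have "[x + g ^ (k * (r mod l) + e j) = x + g ^ (k * (r' mod l) + e j')] (mod t)"
      using y_cong[OF S(1)] y_cong[OF S(2)] by (metis cong_sym cong_trans)
    then have pow: "[k * (r mod l) + e j = k * (r' mod l) + e j'] (mod k * l)"
      by (simp only: cong_add_lcancel_nat power_cong_iff)
    \<comment> \<open>Reducing modulo \<open>k\<close> removes the multipliers, which are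
      \<open>k\<close>-th powers.\<close>
    then have "[k * (r mod l) + e j = k * (r' mod l) + e j'] (mod k)"
      by (rule cong_modulus_mult_nat)
    then have "[e j = e j'] (mod k)"
      by (simp add: cong_def)
    then have "[s + p j = s + p j'] (mod k)"
      using e_cong[OF j(1)] e_cong[OF j(2)] by (metis cong_sym cong_trans)
    then have "p j mod k = p j' mod k"
      by (simp only: cong_add_lcancel_nat) (simp only: cong_def)
    then have "p j = p j'"
      using quot by (metis div_mult_mod_eq)
    then have jj: "j = j'"
      using p_inj j by blast
    then have "[k * (r mod l) = k * (r' mod l)] (mod k * l)"
      using pow by (simp add: cong_add_rcancel_nat)
    then have "r mod l = r' mod l"
      using k_pos l_pos by (simp add: cong_def flip: mult_mod_right)
    then have "r = r'"
      using S jj by (intro row_eqI[of r r' j]) (auto simp: S_def)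
    with jj show "r = r' \<and> j = j'" by simp
  qed
  moreover have "(\<lambda>(r, j). p j div k) ` S \<subseteq> {..<l}"
    using p_less by (auto simp: S_def less_mult_imp_div_less mult.commute)
  ultimately have "card S \<le> card {..<l}"
    by (intro card_inj_on_le) auto
  then show ?thesis
    by (simp add: follow_count_def S_def)
qed

lemma vatican:
  assumes small: "\<And>d. 1 \<le> d \<Longrightarrow> d < k \<Longrightarrow>
      \<exists>i<d. \<exists>s. [s = d + i] (mod k) \<and> [g ^ d = Suc (g ^ s)] (mod t)"
  shows "vatican_design (l * t) t (power_design t k l g)"
  unfolding vatican_design_def
proof (intro conjI ballI allI impI uniform)
  fix d x y assume "d \<in> {1..t - 1}"
  then have d: "1 \<le> d" "d < t"
    using t_gt_1 by auto
  have "\<exists>i<d. \<exists>s. [s = d + i] (mod k) \<and> (d < t - 1 \<longrightarrow> [g ^ d = Suc (g ^ s)] (mod t))"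
  proof (cases "d < k")
    case True
    then show ?thesis using small d by blast
  next
    case False
    obtain s where s: "d < t - 1 \<Longrightarrow> [g ^ d = Suc (g ^ s)] (mod t)"
      using power_eq_Suc_power_if_ord[of t g d] ord_g t_eq d by auto
    \<comment> \<open>This is \<open>s - d\<close> modulo \<open>k\<close>; adding
      \<open>k * d\<close> keeps the difference nonnegative.\<close>
    define i where "i = (s + (k * d - d)) mod k"
    have "(d + i) mod k = (d + (s + (k * d - d))) mod k"
      unfolding i_def by (rule mod_add_right_eq)
    also have "d + (s + (k * d - d)) = s + k * d"
      using mult_le_mono1[of 1 k d] k_pos by linarith
    finally have "[s = d + i] (mod k)"
      by (simp add: cong_def)
    moreover have "i < k"
      using k_pos by (simp add: i_def)
    with False have "i < d" by simp
    ultimately show ?thesis using s by blast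
  qed
  then have "follow_count (l * t) t (power_design t k l g) d x y \<le> l"
    using d follow_count_le by blast
  then show "real (follow_count (l * t) t (power_design t k l g) d x y) \<le> real (l * t) / real t"
    using t_gt_1 by simp
qed

end

section \<open>Numerical certificates for the fifteen pairs\<close>

text \<open>Reduces existence to finite computations: \<open>ps\<close> is the factorization of
  \<open>t - 1\<close> certifying that \<open>g\<close> is a primitive root, and \<open>ds\<close>
  lists for each \<open>d < k\<close> a logarithm \<open>s\<close> of \<open>g ^ d - 1\<close>, with
  \<open>(s - d) mod k\<close> as the required \<open>i\<close>.\<close>

lemma vatican_design_from_logarithms:
  fixes t k l g :: nat
  assumes "t = k * l + 1" "0 < k" "0 < l"
    and "mod_exp g (k * l) t = 1" "foldr (*) ps 1 = k * l"
    and "list_all (\<lambda>p. prime p \<and> mod_exp g (k * l div p) t \<noteq> 1) ps"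
    and ds: "map fst ds = [1..<k]"
      "list_all (\<lambda>(d, s). d \<le> s \<and> (s - d) mod k < d \<and>
        mod_exp g d t = Suc (mod_exp g s t) mod t) ds"
  shows "\<exists>D. vatican_design (l * t) t D"
proof -
  have "ord t g = k * l"
    using assms(1-6) by (intro ord_eqI_prime_list) (auto simp: cong_def mod_exp_def)
  then interpret primitive_power_design t k l g
    using assms(1-3) by unfold_locales
  have "\<exists>i<d. \<exists>s. [s = d + i] (mod k) \<and> [g ^ d = Suc (g ^ s)] (mod t)"
    if d: "1 \<le> d" "d < k" for d
  proof -
    have "d \<in> set (map fst ds)"
      using d by (simp add: ds(1) del: set_map)
    then obtain s where "(d, s) \<in> set ds"
      by auto
    then have s: "d \<le> s" "(s - d) mod k < d" "[g ^ d = Suc (g ^ s)] (mod t)"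
      using ds(2) by (auto simp: list_all_iff cong_def mod_exp_def mod_Suc_eq)
    have "[s = d + (s - d) mod k] (mod k)"
      using s(1) by (simp add: cong_def mod_add_right_eq)
    with s show ?thesis by blast
  qed
  then show ?thesis
    using vatican by blast
qed

theorem theorem9:
  "\<forall>(t, l) \<in> {(61, 10), (71, 14), (79, 13), (101, 20), (109, 18), (113, 16), (131, 26),
      (151, 25), (157, 26), (181, 36), (191, 38), (211, 42), (239, 34), (251, 50), (281, 35)}.
     \<exists>D. vatican_design (l * t) t D"
proof -
  \<comment> \<open>A logarithm \<open>s < d\<close> is raised by \<open>t - 1\<close> to avoid truncated subtraction.\<close>
  have t61: "\<exists>D. vatican_design (10 * 61) 61 D"
    by (rule vatican_design_from_logarithms[where g = 30 and k = 6 and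
          ps = "[2, 2, 3, 5]" and
          ds = "[(1, 55), (2, 26), (3, 51), (4, 6), (5, 14)]"])
      (simp_all add: upt_conv_Cons)
  have t71: "\<exists>D. vatican_design (14 * 71) 71 D"
    by (rule vatican_design_from_logarithms[where g = 55 and k = 5 and
          ps = "[2, 5, 7]" and
          ds = "[(1, 56), (2, 67), (3, 23), (4, 44)]"])
      (simp_all add: upt_conv_Cons)
  have t79: "\<exists>D. vatican_design (13 * 79) 79 D"
    by (rule vatican_design_from_logarithms[where g = 75 and k = 6 and
          ps = "[2, 3, 13]" and
          ds = "[(1, 37), (2, 3), (3, 51), (4, 30), (5, 20)]"])
      (simp_all add: upt_conv_Cons)
  have t101: "\<exists>D. vatican_design (20 * 101) 101 D"
    by (rule vatican_design_from_logarithms[where g = 48 and k = 5 and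
          ps = "[2, 2, 5, 5]" and
          ds = "[(1, 46), (2, 12), (3, 24), (4, 5)]"])
      (simp_all add: upt_conv_Cons)
  have t109: "\<exists>D. vatican_design (18 * 109) 109 D"
    by (rule vatican_design_from_logarithms[where g = 14 and k = 6 and
          ps = "[2, 2, 3, 3, 3]" and
          ds = "[(1, 43), (2, 51), (3, 5), (4, 77), (5, 21)]"])
      (simp_all add: upt_conv_Cons)
  have t113: "\<exists>D. vatican_design (16 * 113) 113 D"
    by (rule vatican_design_from_logarithms[where g = 92 and k = 7 and
          ps = "[2, 2, 2, 2, 7]" and
          ds = "[(1, 78), (2, 65), (3, 40), (4, 88), (5, 36), (6, 85)]"])
      (simp_all add: upt_conv_Cons)
  have t131: "\<exists>D. vatican_design (26 * 131) 131 D"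
    by (rule vatican_design_from_logarithms[where g = 37 and k = 5 and
          ps = "[2, 5, 13]" and
          ds = "[(1, 86), (2, 52), (3, 95), (4, 112)]"])
      (simp_all add: upt_conv_Cons)
  have t151: "\<exists>D. vatican_design (25 * 151) 151 D"
    by (rule vatican_design_from_logarithms[where g = 134 and k = 6 and
          ps = "[2, 3, 5, 5]" and
          ds = "[(1, 79), (2, 14), (3, 112), (4, 76), (5, 139)]"])
      (simp_all add: upt_conv_Cons)
  have t157: "\<exists>D. vatican_design (26 * 157) 157 D"
    by (rule vatican_design_from_logarithms[where g = 21 and k = 6 and
          ps = "[2, 2, 3, 13]" and
          ds = "[(1, 115), (2, 128), (3, 124), (4, 71), (5, 69)]"])
      (simp_all add: upt_conv_Cons)
  have t181: "\<exists>D. vatican_design (36 * 181) 181 D"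
    by (rule vatican_design_from_logarithms[where g = 171 and k = 5 and
          ps = "[2, 2, 3, 3, 5]" and
          ds = "[(1, 56), (2, 102), (3, 13), (4, 52)]"])
      (simp_all add: upt_conv_Cons)
  have t191: "\<exists>D. vatican_design (38 * 191) 191 D"
    by (rule vatican_design_from_logarithms[where g = 58 and k = 5 and
          ps = "[2, 5, 19]" and
          ds = "[(1, 41), (2, 83), (3, 74), (4, 17)]"])
      (simp_all add: upt_conv_Cons)
  have t211: "\<exists>D. vatican_design (42 * 211) 211 D"
    by (rule vatican_design_from_logarithms[where g = 155 and k = 5 and
          ps = "[2, 3, 5, 7]" and
          ds = "[(1, 116), (2, 53), (3, 33), (4, 71)]"])
      (simp_all add: upt_conv_Cons)
  have t239: "\<exists>D. vatican_design (34 * 239) 239 D"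
    by (rule vatican_design_from_logarithms[where g = 156 and k = 7 and
          ps = "[2, 7, 17]" and
          ds = "[(1, 8), (2, 142), (3, 221), (4, 32), (5, 211), (6, 238)]"])
      (simp_all add: upt_conv_Cons)
  have t251: "\<exists>D. vatican_design (50 * 251) 251 D"
    by (rule vatican_design_from_logarithms[where g = 29 and k = 5 and
          ps = "[2, 5, 5, 5]" and
          ds = "[(1, 96), (2, 203), (3, 238), (4, 181)]"])
      (simp_all add: upt_conv_Cons)
  have t281: "\<exists>D. vatican_design (35 * 281) 281 D"
    by (rule vatican_design_from_logarithms[where g = 13 and k = 8 and
          ps = "[2, 2, 2, 5, 7]" and
          ds = "[(1, 201), (2, 275), (3, 93), (4, 119), (5, 239), (6, 17), (7, 285)]"])
      (simp_all add: upt_conv_Cons)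
  show ?thesis
    using t61 t71 t79 t101 t109 t113 t131 t151
      t157 t181 t191 t211 t239 t251 t281
    by simp
qed

end
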